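(* Fix $d\in\mathbb{N}$, $d\ge1$. Suppose that $\mathbb{V}$ is the variance function of the CSK family generated by a non-degenerate compactly supported probability measure $\nu$ on $\mathbb{R}$ with mean $0$ and variance $1$. Consider the family of polynomials $\{P_n(x)\}_{n\ge0}$ with generating function $$\frac{\mathbb{V}(m)}{\mathbb{V}(m)+m(m-x)}=\sum_{n=0}^\infty P_n(x)m^n$$ (power series expansion at $m=0$). Then the following statements are equivalent: (1) $\mathbb{V}(m)=1+\sum_{k=1}^{d+1}a_km^k$ is a polynomial of degree at most $d+1$ (for some real $a_1,\dots,a_{d+1}$); (2) there exist real constants $b_1,\dots,b_{d+1}$ such that the polynomials $\{P_n\}$ satisfy $P_0(x)=1$, $P_1(x)=x$, $$xP_1(x)=P_2(x)+b_1P_1(x)+P_0(x),$$ and $$xP_n(x)=P_{n+1}(x)+\sum_{k=1}^{\min(d+1,n)}b_kP_{n+1-k}(x),\qquad n\ge 2;$$ (3) the polynomials $\{P_n\}$ are $(\nu;d)$-orthogonal.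
   Context: Let $\nu$ be a non-degenerate compactly supported probability measure on $\mathbb{R}$ with $\int x\,\nu(dx)=0$. The variance function $\mathbb{V}_\nu$ of the Cauchy-Stieltjes Kernel (CSK) family generated by $\nu$ is the unique function $\mathbb{V}$, real analytic in a neighbourhood of $0$ with $\mathbb{V}(0)\neq 0$, such that for all $m$ in some open interval $(m_-,m_+)$ containing $0$ the formula $$Q_m(dx)=f(x,m)\,\nu(dx),\qquad f(x,m)=\frac{\mathbb{V}(m)}{\mathbb{V}(m)+m(m-x)}\ (m\ne 0),\quad f(x,0)=1,$$ defines a probability measure. (Existence and uniqueness are known; one then has $\int x\,Q_m(dx)=m$ and $\mathbb{V}(m)=\int (x-m)^2 Q_m(dx)$, so $\mathbb{V}_\nu(0)=\int x^2\nu(dx)$.) Variance functions are regarded as germs at $0$. For $d\in\mathbb{N}$ and a probability measure $\nu$ with moments of all orders, real polynomials $\{P_n\}_{n\ge0}$, indexed by their degree $n$ with $P_0=1$, are called $(\nu;d)$-orthogonal if $\int P_n(x)\,\nu(dx)=0$ for all $n\ge1$ and $\int P_n(x)P_k(x)\,\nu(dx)=0$ for all $k=1,2,\dots$ and all $n\ge 2+(k-1)d$. *)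

theory Defs
  imports "HOL-Probability.Probability"
begin

definition real_analytic_on :: "(real \<Rightarrow> real) \<Rightarrow> real set \<Rightarrow> bool"  (infix "real'_analytic'_on" 50)
  where "f real_analytic_on S \<longleftrightarrow> (\<forall>a\<in>S. \<exists>F. (\<lambda>t. f (a + t)) has_fps_expansion F)"

definition nondegenerate :: "real measure \<Rightarrow> bool"
  where "nondegenerate \<nu> \<longleftrightarrow> (\<nexists>c. \<nu> = return borel c)"

definition compactly_supported :: "real measure \<Rightarrow> bool"
  where "compactly_supported \<nu> \<longleftrightarrow> (\<exists>K. compact K \<and> (AE x in \<nu>. x \<in> K))"

definition csk_density :: "(real \<Rightarrow> real) \<Rightarrow> real \<Rightarrow> real \<Rightarrow> real"
  where "csk_density V x m = (if m = 0 then 1 else V m / (V m + m * (m - x)))"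

text \<open>A variance function is only determined as a germ at \<open>0\<close>; the predicate holds for
  every total function \<open>V\<close> representing that germ.  The almost-everywhere condition says that
  the density is a genuine non-negative function: the denominator must not vanish (division by
  zero would silently yield \<open>0\<close>), and \<open>ennreal\<close> would truncate negative values.\<close>

definition csk_variance_function :: "real measure \<Rightarrow> (real \<Rightarrow> real) \<Rightarrow> bool"
  where "csk_variance_function \<nu> V \<longleftrightarrow>
    (\<exists>U. open U \<and> 0 \<in> U \<and> V real_analytic_on U) \<and> V 0 \<noteq> 0 \<and>
    (\<exists>m_minus m_plus. m_minus < 0 \<and> 0 < m_plus \<and>
      (\<forall>m\<in>{m_minus<..<m_plus}.
        (AE x in \<nu>. V m + m * (m - x) \<noteq> 0 \<and> 0 \<le> csk_density V x m) \<and>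
        prob_space (density \<nu> (\<lambda>x. ennreal (csk_density V x m)))))"

text \<open>The moment condition is part of the predicate because the Bochner integral of a
  non-integrable function is \<open>0\<close>.\<close>

definition d_orthogonal :: "real measure \<Rightarrow> nat \<Rightarrow> (nat \<Rightarrow> real poly) \<Rightarrow> bool"
  where "d_orthogonal \<nu> d P \<longleftrightarrow>
    (\<forall>n. integrable \<nu> (\<lambda>x. x ^ n)) \<and>
    (\<forall>n. degree (P n) = n) \<and> P 0 = 1 \<and>
    (\<forall>n\<ge>1. (LINT x|\<nu>. poly (P n) x) = 0) \<and>
    (\<forall>k\<ge>1. \<forall>n\<ge>2 + (k - 1) * d. (LINT x|\<nu>. poly (P n) x * poly (P k) x) = 0)"

end

theory Submission
  imports Defs
begin

text \<open>
  Let \<open>W = \<Sum> v\<^sub>k m\<^sup>k\<close> be the power series of \<open>V\<close>.  Multiplying the generating function by its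
  denominator \<open>W + m\<^sup>2 - x m\<close> and comparing coefficients gives a recurrence for
  \<open>x P\<^sub>n\<close> whose coefficients are those of \<open>W\<close>, except that \<open>m\<^sup>2\<close> raises \<open>v\<^sub>2\<close> by one:
  \<open>c\<^sub>k = v\<^sub>k + [k = 2]\<close> (\<open>csk_polynomial_recurrence\<close>).  In general the recurrence
  reaches all the way down to \<open>P\<^sub>1\<close>.  Each of the three statements says that it is
  banded, that is, \<open>c\<^sub>k = 0\<close> for all \<open>k > d + 1\<close>:

  \<^item> for the polynomial shape of \<open>V\<close> this is uniqueness of power series
    (\<open>eventually_polynomial_iff\<close>);

  \<^item> for the finite recurrence it is uniqueness of the coefficients
    (\<open>banded_recurrence_iff\<close>);

  \<^item> for orthogonality, bandedness lets powers of \<open>x\<close> pass to \<open>P\<^sub>n\<close> without reaching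
    \<open>P\<^sub>0\<close>, and conversely orthogonality to \<open>P\<^sub>1\<close> makes \<open>c\<^sub>k\<close> the integral of \<open>x\<^sup>2 P\<^sub>k\<close>, which vanishes for
    \<open>k > d + 1\<close> if \<open>P\<^sub>k\<close> is orthogonal to \<open>P\<^sub>0\<close>, \<open>P\<^sub>1\<close> and \<open>P\<^sub>2\<close> (\<open>orthogonal_iff\<close>).

  The only analytic input is that \<open>P\<^sub>n\<close> has integral \<open>0\<close> for \<open>n \<ge> 1\<close>
  (\<open>csk_polynomials_integral_0\<close>): the generating function is a probability density for every small
  \<open>m\<close>, and on a bounded support it may be integrated term by term.  This also yields the
  normalisation \<open>v\<^sub>0 = V 0 = 1\<close>, since integrating \<open>x P\<^sub>1 = v\<^sub>0 P\<^sub>2 + v\<^sub>1 P\<^sub>1 + P\<^sub>0\<close>, where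
  \<open>v\<^sub>0 P\<^sub>1 = x\<close>, compares the variance \<open>1\<close> with \<open>v\<^sub>0\<close>.
\<close>

section \<open>Banded recurrences and orthogonality\<close>

text \<open>The instance \<open>n = 1\<close> stands apart because \<open>P (n - 1)\<close> is then \<open>P 0\<close>, which enters with
  coefficient \<open>1\<close> (from the term \<open>m\<^sup>2\<close> of the denominator) instead of \<open>c 2\<close>.\<close>

locale csk_polynomials =
  fixes P :: "nat \<Rightarrow> real poly" and c :: "nat \<Rightarrow> real"
  assumes P_0: "P 0 = 1"
    and P_1: "P 1 = [:0, 1:]"
    and rec_1: "[:0, 1:] * P 1 = P 2 + smult (c 1) (P 1) + P 0"
    and rec: "n \<ge> 2 \<Longrightarrow> [:0, 1:] * P n = P (n + 1) + (\<Sum>k=1..n. smult (c k) (P (n + 1 - k)))"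
begin

lemma degree_P: "degree (P n) = n"
proof (induction n rule: less_induct)
  case (less n)
  consider "n = 0" | "n = 1" | "n = 2" | m where "n = Suc m" "m \<ge> 2"
    by (metis One_nat_def Suc_1 le_less_linear less_2_cases not0_implies_Suc)
  then show ?case
  proof cases
    case 1 then show ?thesis by (simp add: P_0)
  next
    case 2 then show ?thesis by (simp add: P_1[simplified])
  next
    case 3
    have "P 2 = [:0, 1:] * [:0, 1:] - smult (c 1) [:0, 1:] - 1"
      using rec_1 unfolding P_0 P_1 by (simp add: algebra_simps)
    then show ?thesis using 3 by (simp add: one_pCons)
  next
    case 4
    let ?S = "\<Sum>k=1..m. smult (c k) (P (m + 1 - k))"
    have S: "degree ?S \<le> m"
    proof (rule degree_sum_le)
      fix k assume k: "k \<in> {1..m}"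
      then have "degree (P (m + 1 - k)) = m + 1 - k"
        using 4 by (intro less.IH) auto
      with k show "degree (smult (c k) (P (m + 1 - k))) \<le> m"
        by (intro le_trans[OF degree_smult_le]) auto
    qed simp
    have dm: "degree (P m) = m" using 4 less.IH by simp
    then have "P m \<noteq> 0" using 4 by auto
    then have "degree ([:0, 1:] * P m) = Suc m"
      using dm by (subst degree_mult_eq) auto
    moreover have "P n = [:0, 1:] * P m + - ?S"
      using rec[OF 4(2)] 4(1) by (simp add: algebra_simps)
    ultimately show ?thesis
      using S 4(1) by (simp only: degree_minus degree_add_eq_left le_imp_less_Suc)
  qed
qed

text \<open>The coefficients of such a recurrence are unique: in the instance for \<open>n\<close>, the only
  coefficient that does not already occur in the instance for \<open>n - 1\<close> is the one of
  \<open>P 1\<close>, so that a second sequence \<open>b\<close>, continued by \<open>0\<close>, is found to agree with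
  \<open>c\<close> one index after the other.\<close>

lemma banded_recurrence_iff:
  "(\<exists>b :: nat \<Rightarrow> real. P 0 = 1 \<and> P 1 = [:0, 1:] \<and>
      [:0, 1:] * P 1 = P 2 + smult (b 1) (P 1) + P 0 \<and>
      (\<forall>n\<ge>2. [:0, 1:] * P n = P (n + 1) + (\<Sum>k=1..min (d + 1) n. smult (b k) (P (n + 1 - k)))))
    \<longleftrightarrow> (\<forall>k>d+1. c k = 0)" (is "(\<exists>b. ?R b) \<longleftrightarrow> _")
proof
  assume band: "\<forall>k>d+1. c k = 0"
  have "?R c"
  proof (intro conjI allI impI)
    fix n :: nat assume "n \<ge> 2"
    have "(\<Sum>k=1..n. smult (c k) (P (n + 1 - k)))
        = (\<Sum>k=1..min (d + 1) n. smult (c k) (P (n + 1 - k)))"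
      using band by (intro sum.mono_neutral_right) auto
    then show "[:0, 1:] * P n = P (n + 1) + (\<Sum>k=1..min (d + 1) n. smult (c k) (P (n + 1 - k)))"
      using rec[OF \<open>n \<ge> 2\<close>] by simp
  qed (use P_0 P_1 rec_1 in auto)
  then show "\<exists>b. ?R b" by blast
next
  assume "\<exists>b. ?R b"
  then obtain b where b1: "[:0, 1:] * P 1 = P 2 + smult (b 1) (P 1) + P 0"
    and b: "\<And>n. n \<ge> 2 \<Longrightarrow>
      [:0, 1:] * P n = P (n + 1) + (\<Sum>k=1..min (d + 1) n. smult (b k) (P (n + 1 - k)))"
    by blast
  define e where "e k = c k - (if k \<le> d + 1 then b k else 0)" for k
  have P1_nz: "P 1 \<noteq> 0" unfolding P_1 by simp
  have e: "e k = 0" if "k \<ge> 1" for k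
    using that
  proof (induction k rule: less_induct)
    case (less k)
    show ?case
    proof (cases "k = 1")
      case True
      have "smult (c 1) (P 1) = smult (b 1) (P 1)"
        using rec_1 b1 by (simp add: algebra_simps)
      then have "smult (c 1 - b 1) (P 1) = 0" by (simp add: smult_diff_left)
      then show ?thesis using P1_nz True by (simp add: e_def)
    next
      case False
      then have k2: "k \<ge> 2" using less.prems by simp
      have "(\<Sum>i=1..min (d + 1) k. smult (b i) (P (k + 1 - i)))
          = (\<Sum>i=1..k. smult (if i \<le> d + 1 then b i else 0) (P (k + 1 - i)))"
        by (intro sum.mono_neutral_cong_left) auto
      then have "(\<Sum>i=1..k. smult (e i) (P (k + 1 - i))) = 0"
        using rec[OF k2] b[OF k2]
        by (simp add: e_def smult_diff_left sum_subtractf)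
      moreover have "(\<Sum>i=1..k. smult (e i) (P (k + 1 - i)))
          = (\<Sum>i\<in>{k}. smult (e i) (P (k + 1 - i)))"
        using less by (intro sum.mono_neutral_right) auto
      ultimately show ?thesis using P1_nz by simp
    qed
  qed
  show "\<forall>k>d+1. c k = 0"
  proof (intro allI impI)
    fix k assume "k > d + 1"
    then show "c k = 0"
      using e[of k] by (simp add: e_def)
  qed
qed

end

locale csk_moment_functional = csk_polynomials +
  fixes L :: "real poly \<Rightarrow> real"
  assumes L_add: "L (p + q) = L p + L q"
    and L_smult: "L (smult a p) = a * L p"
    and L_1: "L 1 = 1"
    and L_P: "n \<ge> 1 \<Longrightarrow> L (P n) = 0"
begin

lemma L_sum: "L (\<Sum>i\<in>A. f i) = (\<Sum>i\<in>A. L (f i))"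
proof -
  have "L 0 = 0" using L_smult[of 0 0] by simp
  then show ?thesis by (induction A rule: infinite_finite_induct) (auto simp: L_add)
qed

text \<open>Multiplication by the variable lowers the index of \<open>P n\<close> by at most \<open>d\<close>, so that
  after \<open>j\<close> of the \<open>Suc j\<close> factors all indices are still at least \<open>2\<close>.  From there one more
  factor reaches \<open>P 1\<close> at the lowest, because only the product of the variable with \<open>P 1\<close>
  contains \<open>P 0\<close>, and \<open>L\<close> kills every polynomial of positive index.\<close>

lemma L_power_times_P:
  assumes band: "\<forall>k>d+1. c k = 0" and "n \<ge> 2 + j * d"
  shows "L ([:0, 1:] ^ Suc j * P n) = 0"
  using assms(2)
proof (induction j arbitrary: n)
  case 0
  have "(\<Sum>k=1..n. c k * L (P (n + 1 - k))) = 0"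
  proof (intro sum.neutral ballI)
    fix k assume "k \<in> {1..n}"
    then have "L (P (n + 1 - k)) = 0" by (intro L_P) auto
    then show "c k * L (P (n + 1 - k)) = 0" by simp
  qed
  then show ?case
    using rec[of n] 0 by (simp add: L_add L_sum L_smult L_P del: mult_pCons_left)
next
  case (Suc j)
  let ?x = "[:0, 1:] :: real poly"
  have n2: "n \<ge> 2" using Suc.prems by simp
  have "?x ^ Suc (Suc j) * P n = ?x ^ Suc j * (?x * P n)"
    by (simp only: power_Suc2 mult.assoc)
  also have "\<dots> = ?x ^ Suc j * P (n + 1) + (\<Sum>k=1..n. smult (c k) (?x ^ Suc j * P (n + 1 - k)))"
    unfolding rec[OF n2] by (simp only: distrib_left sum_distrib_left mult_smult_right)
  finally have "L (?x ^ Suc (Suc j) * P n)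
      = L (?x ^ Suc j * P (n + 1)) + (\<Sum>k=1..n. c k * L (?x ^ Suc j * P (n + 1 - k)))"
    by (simp only: L_add L_sum L_smult)
  also have "L (?x ^ Suc j * P (n + 1)) = 0"
    using Suc.prems by (intro Suc.IH) auto
  also have "(\<Sum>k=1..n. c k * L (?x ^ Suc j * P (n + 1 - k))) = 0"
  proof (rule sum.neutral, rule ballI)
    fix k assume "k \<in> {1..n}"
    show "c k * L (?x ^ Suc j * P (n + 1 - k)) = 0"
    proof (cases "k > d + 1")
      case False
      then have "L (?x ^ Suc j * P (n + 1 - k)) = 0"
        using Suc.prems by (intro Suc.IH) auto
      then show ?thesis by simp
    qed (use band in simp)
  qed
  finally show ?case by simp
qed

text \<open>A banded recurrence makes \<open>P n\<close> orthogonal to all low powers of the variable, hence to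
  \<open>P k\<close>.  Conversely, orthogonality against \<open>P 1\<close> and \<open>P 2\<close> alone determines the band:
  orthogonality against \<open>P 1\<close> makes \<open>c k\<close> the value of \<open>L\<close> at the square of the variable
  times \<open>P k\<close>, which then vanishes by orthogonality of \<open>P k\<close> against \<open>P 1\<close> and \<open>P 2\<close>.\<close>

lemma orthogonal_iff:
  "(\<forall>k\<ge>1. \<forall>n\<ge>2 + (k - 1) * d. L (P n * P k) = 0) \<longleftrightarrow> (\<forall>k>d+1. c k = 0)"
proof (intro iffI allI impI)
  fix k n :: nat
  assume band: "\<forall>k>d+1. c k = 0" and k: "k \<ge> 1" and n: "n \<ge> 2 + (k - 1) * d"
  have "L (P n * P k) = L (\<Sum>i\<le>k. smult (coeff (P k) i) ([:0, 1:] ^ i * P n))"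
  proof -
    have "P k = (\<Sum>i\<le>k. smult (coeff (P k) i) ([:0, 1:] ^ i))"
      using poly_as_sum_of_monoms[of "P k"] by (simp add: degree_P monom_altdef)
    then have "P k * P n = (\<Sum>i\<le>k. smult (coeff (P k) i) ([:0, 1:] ^ i)) * P n"
      by (rule arg_cong)
    then show ?thesis by (simp add: sum_distrib_right mult.commute[of "P n"])
  qed
  also have "\<dots> = (\<Sum>i\<le>k. coeff (P k) i * L ([:0, 1:] ^ i * P n))"
    by (simp only: L_sum L_smult)
  also have "\<dots> = 0"
  proof (rule sum.neutral, rule ballI)
    fix i assume i: "i \<in> {..k}"
    have "L ([:0, 1:] ^ i * P n) = 0"
    proof (cases i)
      case 0
      then show ?thesis using n L_P by simp
    next
      case (Suc j)
      have "j * d \<le> (k - 1) * d" using i Suc by (intro mult_right_mono) auto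
      then have "n \<ge> 2 + j * d" using n by linarith
      then show ?thesis unfolding Suc by (rule L_power_times_P[OF band])
    qed
    then show "coeff (P k) i * L ([:0, 1:] ^ i * P n) = 0" by simp
  qed
  finally show "L (P n * P k) = 0" .
next
  fix k :: nat
  assume orth: "\<forall>k\<ge>1. \<forall>n\<ge>2 + (k - 1) * d. L (P n * P k) = 0" and "k > d + 1"
  then have k: "k \<ge> d + 2" by simp
  have orth1: "L (P 1 * P n) = 0" if "n \<ge> 2" for n
    using orth[rule_format, of 1 n] that by (simp add: mult.commute)
  have L_sq: "L (P 1 * P 1) = 1"
    using rec_1 unfolding P_1[symmetric] by (simp add: L_add L_smult L_P L_1 P_0 del: One_nat_def)
  \<comment> \<open>The square of \<open>P 1\<close> is expanded in \<open>P 0\<close>, \<open>P 1\<close>, \<open>P 2\<close> on one side; on the other side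
      the recurrence for \<open>P k\<close> is applied, and only its term in \<open>P 1\<close> survives.\<close>
  have "L ((P 1 * P 1) * P k) = L (P 1 * (P 1 * P k))"
    by (simp only: mult.assoc)
  also have "P 1 * P 1 = P 2 + smult (c 1) (P 1) + P 0"
    using rec_1 unfolding P_1[symmetric] .
  also have "L ((P 2 + smult (c 1) (P 1) + P 0) * P k) = 0"
    using orth[rule_format, of 2 k] orth1[of k] k
    by (simp add: distrib_right L_add L_smult P_0 L_P mult.commute[of "P 2"] del: One_nat_def)
  also have "P 1 * P k = P (k + 1) + (\<Sum>i=1..k. smult (c i) (P (k + 1 - i)))"
    using rec[of k] k unfolding P_1[symmetric] by simp
  also have "L (P 1 * (P (k + 1) + (\<Sum>i=1..k. smult (c i) (P (k + 1 - i)))))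
      = L (P 1 * P (k + 1)) + (\<Sum>i=1..k. c i * L (P 1 * P (k + 1 - i)))"
    by (simp only: distrib_left sum_distrib_left mult_smult_right L_add L_sum L_smult)
  also have "\<dots> = (\<Sum>i\<in>{k}. c i * L (P 1 * P (k + 1 - i)))"
  proof -
    have "L (P 1 * P (k + 1)) = 0" using k by (intro orth1) simp
    moreover have "(\<Sum>i=1..k. c i * L (P 1 * P (k + 1 - i)))
        = (\<Sum>i\<in>{k}. c i * L (P 1 * P (k + 1 - i)))"
    proof (intro sum.mono_neutral_right ballI)
      fix i assume "i \<in> {1..k} - {k}"
      then have "L (P 1 * P (k + 1 - i)) = 0" by (intro orth1) auto
      then show "c i * L (P 1 * P (k + 1 - i)) = 0" by simp
    qed (use k in auto)
    ultimately show ?thesis by simp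
  qed
  also have "\<dots> = c k" using L_sq by simp
  finally show "c k = 0" by simp
qed

end


section \<open>Power series expansions over the reals\<close>

text \<open>Dividing by \<open>m ^ n\<close> leaves a function that is again given by a power series, and the
  bound forces its value at \<open>0\<close>, the first coefficient not yet known to vanish, to be \<open>0\<close>.\<close>

lemma has_fps_expansion_bigo_imp_nth_0:
  fixes h :: "real \<Rightarrow> real"
  assumes h: "h has_fps_expansion H"
    and bound: "\<forall>\<^sub>F m in nhds 0. \<bar>h m\<bar> \<le> C * \<bar>m\<bar> ^ Suc N"
    and "n \<le> N"
  shows "fps_nth H n = 0"
  using assms(3)
proof (induction n rule: less_induct)
  case (less n)
  show ?case
  proof (cases "H = 0")
    case False
    then have sub: "n \<le> subdegree H"
      using less by (intro subdegree_geI) auto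
    define q where "q x = (if x = 0 then fps_nth H n else h x / x ^ n)" for x
    have "q has_fps_expansion fps_shift n H"
      unfolding q_def using has_fps_expansion_shift[OF h sub refl] .
    then have "isCont q 0"
      by (rule has_fps_expansion_imp_continuous)
    then have lim: "(q \<longlongrightarrow> fps_nth H n) (at 0)"
      by (simp add: isCont_def q_def)
    have "\<forall>\<^sub>F m in at 0. norm (q m) \<le> C * \<bar>m\<bar> ^ Suc (N - n)"
      unfolding eventually_at_filter using bound
    proof (eventually_elim, intro impI)
      fix m :: real assume b: "\<bar>h m\<bar> \<le> C * \<bar>m\<bar> ^ Suc N" and "m \<noteq> 0"
      have "\<bar>m\<bar> ^ Suc N = \<bar>m\<bar> ^ Suc (N - n) * \<bar>m\<bar> ^ n"
        using less.prems by (simp flip: power_add)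
      then show "norm (q m) \<le> C * \<bar>m\<bar> ^ Suc (N - n)"
        using b \<open>m \<noteq> 0\<close> by (simp add: q_def field_simps power_abs abs_mult)
    qed
    moreover have "((\<lambda>m. C * \<bar>m\<bar> ^ Suc (N - n)) \<longlongrightarrow> 0) (at (0::real))"
      by (rule tendsto_eq_intros refl | simp)+
    ultimately have "(q \<longlongrightarrow> 0) (at 0)"
      by (rule Lim_null_comparison)
    then show ?thesis using lim LIM_unique by blast
  qed simp
qed

lemma has_fps_expansion_unique_real:
  fixes f g :: "real \<Rightarrow> real"
  assumes f: "f has_fps_expansion F" and g: "g has_fps_expansion G"
    and eq: "\<forall>\<^sub>F m in nhds 0. f m = g m"
  shows "F = G"
proof (rule fps_ext)
  fix n
  have "(\<lambda>m. f m - g m) has_fps_expansion F - G"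
    using f g by (rule has_fps_expansion_diff)
  then have "fps_nth (F - G) n = 0"
    by (rule has_fps_expansion_bigo_imp_nth_0[where C = 0 and N = n])
       (use eq in \<open>auto elim: eventually_mono\<close>)
  then show "fps_nth F n = fps_nth G n" by simp
qed

lemma has_fps_expansion_nth_0_real:
  fixes f :: "real \<Rightarrow> real"
  assumes "f has_fps_expansion F"
  shows "fps_nth F 0 = f 0"
proof -
  have "eval_fps F 0 = f 0"
    using assms unfolding has_fps_expansion_def by (blast dest: eventually_nhds_x_imp_x)
  then show ?thesis by (simp add: eval_fps_at_0)
qed

lemma has_fps_expansion_power_real:
  fixes f :: "real \<Rightarrow> real"
  assumes "f has_fps_expansion F"
  shows "(\<lambda>m. f m ^ j) has_fps_expansion F ^ j"
  using has_fps_expansion_prod[of "{..<j}" "\<lambda>_. f" "\<lambda>_. F"] assms by simp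

lemma has_fps_expansion_eventually_bounded:
  fixes f :: "real \<Rightarrow> real"
  assumes "f has_fps_expansion F"
  shows "\<forall>\<^sub>F m in nhds 0. \<bar>f m\<bar> \<le> \<bar>f 0\<bar> + 1"
proof -
  have "isCont f 0"
    using assms by (rule has_fps_expansion_imp_continuous)
  then have "((\<lambda>m. \<bar>f m\<bar>) \<longlongrightarrow> \<bar>f 0\<bar>) (nhds 0)"
    by (intro tendsto_rabs) (simp add: isCont_def tendsto_at_iff_tendsto_nhds)
  then have "\<forall>\<^sub>F m in nhds 0. \<bar>f m\<bar> < \<bar>f 0\<bar> + 1"
    by (rule order_tendstoD) simp
  then show ?thesis by (auto elim: eventually_mono)
qed

lemma eventually_polynomial_iff:
  fixes V :: "real \<Rightarrow> real"
  assumes V: "V has_fps_expansion W" and W0: "fps_nth W 0 = 1"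
  shows "(\<exists>a :: nat \<Rightarrow> real. \<forall>\<^sub>F m in nhds 0. V m = 1 + (\<Sum>k=1..D. a k * m ^ k))
    \<longleftrightarrow> (\<forall>k>D. fps_nth W k = 0)"
proof -
  define F :: "(nat \<Rightarrow> real) \<Rightarrow> real fps"
    where "F a = 1 + (\<Sum>k=1..D. fps_const (a k) * fps_X ^ k)" for a
  have F: "(\<lambda>m. 1 + (\<Sum>k=1..D. a k * m ^ k)) has_fps_expansion F a" for a
    unfolding F_def by (intro fps_expansion_intros)
  have nth_F: "fps_nth (F a) n = (if n = 0 then 1 else if n \<le> D then a n else 0)" for a n
  proof -
    have "fps_nth (F a) n = fps_nth 1 n + (\<Sum>k=1..D. if k = n then a k else 0)"
      unfolding F_def fps_add_nth fps_sum_nth by (intro arg_cong2[where f = "(+)"] sum.cong) auto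
    also have "(\<Sum>k=1..D. if k = n then a k else 0) = (if 1 \<le> n \<and> n \<le> D then a n else 0)"
      by (subst sum.delta) auto
    finally show ?thesis by auto
  qed
  show ?thesis
  proof
    assume "\<exists>a :: nat \<Rightarrow> real. \<forall>\<^sub>F m in nhds 0. V m = 1 + (\<Sum>k=1..D. a k * m ^ k)"
    then obtain a :: "nat \<Rightarrow> real" where "\<forall>\<^sub>F m in nhds 0. V m = 1 + (\<Sum>k=1..D. a k * m ^ k)"
      by blast
    then have "W = F a" by (rule has_fps_expansion_unique_real[OF V F])
    then show "\<forall>k>D. fps_nth W k = 0" by (simp add: nth_F)
  next
    assume "\<forall>k>D. fps_nth W k = 0"
    then have "F (fps_nth W) = W" by (intro fps_ext) (use W0 in \<open>auto simp: nth_F\<close>)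
    then have "\<forall>\<^sub>F m in nhds 0. eval_fps W m = 1 + (\<Sum>k=1..D. fps_nth W k * m ^ k)"
      using F[of "fps_nth W"] unfolding has_fps_expansion_def by simp
    moreover have "\<forall>\<^sub>F m in nhds 0. eval_fps W m = V m"
      using V unfolding has_fps_expansion_def by blast
    ultimately have "\<forall>\<^sub>F m in nhds 0. V m = 1 + (\<Sum>k=1..D. fps_nth W k * m ^ k)"
      by eventually_elim simp
    then show "\<exists>a :: nat \<Rightarrow> real. \<forall>\<^sub>F m in nhds 0. V m = 1 + (\<Sum>k=1..D. a k * m ^ k)"
      by blast
  qed
qed

section \<open>The generating function\<close>

text \<open>The recurrence, as an identity of formal power series in \<open>m\<close> for fixed \<open>x\<close>.\<close>

lemma csk_fps_functional_equation:
  fixes V :: "real \<Rightarrow> real"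
  assumes V: "V has_fps_expansion W" and W0: "fps_nth W 0 \<noteq> 0"
    and A: "(\<lambda>m. V m / (V m + m * (m - x))) has_fps_expansion A"
  shows "A * (W + fps_X * (fps_X - fps_const x)) = W"
proof -
  define D where "D = W + fps_X * (fps_X - fps_const x)"
  have D: "(\<lambda>m. V m + m * (m - x)) has_fps_expansion D"
    unfolding D_def by (intro fps_expansion_intros V)
  have D0: "fps_nth D 0 \<noteq> 0"
    using W0 by (simp add: D_def)
  have "(\<lambda>m. V m / (V m + m * (m - x))) has_fps_expansion W / D"
    by (intro has_fps_expansion_divide' V D D0)
  then have "A = W / D"
    by (intro has_fps_expansion_unique_real[OF A]) auto
  then show ?thesis
    using D0 by (simp add: fps_divide_unit mult.assoc inverse_mult_eq_1 flip: D_def)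
qed

text \<open>This compares the coefficients at \<open>n + 1\<close>.  On the left the term with index \<open>n + 1\<close> of
  \<open>W\<close> is multiplied by \<open>P 0 = 1\<close> and cancels against the right-hand side, which is why the sum
  stops at \<open>n\<close>; the term \<open>P (n - 1)\<close> is the contribution of \<open>m\<^sup>2\<close>.\<close>

lemma csk_polynomial_recurrence:
  fixes W :: "real fps" and P :: "nat \<Rightarrow> real poly"
  assumes W0: "fps_nth W 0 \<noteq> 0"
    and eq: "\<And>x. Abs_fps (\<lambda>n. poly (P n) x) * (W + fps_X * (fps_X - fps_const x)) = W"
  shows "P 0 = 1"
    and "[:0, 1:] * P n = (\<Sum>k\<le>n. smult (fps_nth W k) (P (n + 1 - k)))
           + (if n = 0 then 0 else P (n - 1))"
proof -
  have "poly (P 0) x = 1" for x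
    using arg_cong[OF eq[of x], of "\<lambda>F. fps_nth F 0"] W0 by simp
  then show P0: "P 0 = 1"
    by (simp add: fun_eq_iff flip: poly_eq_poly_eq_iff)
  have "poly ([:0, 1:] * P n) x = poly ((\<Sum>k\<le>n. smult (fps_nth W k) (P (n + 1 - k)))
           + (if n = 0 then 0 else P (n - 1))) x" for x
  proof -
    define A where "A = Abs_fps (\<lambda>n. poly (P n) x)"
    have "W = W * A + fps_X * (fps_X * A) - fps_X * (fps_const x * A)"
      using eq[of x] unfolding A_def by (simp add: algebra_simps)
    then have "fps_nth W (n + 1) = fps_nth (W * A + fps_X * (fps_X * A) - fps_X * (fps_const x * A)) (n + 1)"
      by (rule arg_cong)
    also have "\<dots> = fps_nth (W * A) (n + 1) + (if n = 0 then 0 else poly (P (n - 1)) x) - x * poly (P n) x"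
      by (simp add: A_def)
    also have "fps_nth (W * A) (n + 1)
        = (\<Sum>k\<le>n. fps_nth W k * poly (P (n + 1 - k)) x) + fps_nth W (n + 1)"
      using P0 by (simp add: fps_mult_nth A_def atLeast0AtMost)
    finally have "x * poly (P n) x = (\<Sum>k\<le>n. fps_nth W k * poly (P (n + 1 - k)) x)
        + (if n = 0 then 0 else poly (P (n - 1)) x)"
      by (simp only: algebra_simps)
    then show ?thesis
      by (cases "n = 0") (simp_all add: poly_sum)
  qed
  then show "[:0, 1:] * P n = (\<Sum>k\<le>n. smult (fps_nth W k) (P (n + 1 - k)))
           + (if n = 0 then 0 else P (n - 1))"
    by (simp flip: poly_eq_poly_eq_iff add: fun_eq_iff del: mult_pCons_left)
qed

text \<open>The generating function equals \<open>G / (1 - x T)\<close> with \<open>G = W / (W + X\<^sup>2)\<close> and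
  \<open>T = X / (W + X\<^sup>2)\<close>.  As \<open>T\<close> has no constant term, the geometric series in \<open>x T\<close>
  may be cut off after \<open>N\<close> without changing the coefficients up to order \<open>N\<close>; in this
  form the coefficients are visibly finite sums of powers of \<open>x\<close>, which are easy to integrate.\<close>

lemma csk_coeff_geometric:
  fixes W :: "real fps" and x :: real
  assumes W0: "fps_nth W 0 \<noteq> 0"
    and A: "A * (W + fps_X * (fps_X - fps_const x)) = W"
    and "n \<le> N"
  defines "I \<equiv> inverse (W + fps_X ^ 2)"
  shows "fps_nth A n = (\<Sum>j\<le>N. x ^ j * fps_nth (W * I * (fps_X * I) ^ j) n)"
proof -
  define E where "E = W + fps_X ^ 2"
  define z where "z = fps_const x * (fps_X * I)"
  have IE: "I * E = 1"
    unfolding I_def E_def using W0 by (intro inverse_mult_eq_1) simp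
  have "W + fps_X * (fps_X - fps_const x) = E - fps_const x * fps_X"
    by (simp add: E_def power2_eq_square algebra_simps)
  then have "A * (I * E - z) = W * I"
    using arg_cong[OF A, of "\<lambda>F. F * I"] by (simp add: z_def algebra_simps)
  then have "W * I = A * (1 - z)" by (simp add: IE)
  then have "W * I * (\<Sum>j\<le>N. z ^ j) = A * (1 - z ^ Suc N)"
    using one_diff_power_eq[of z "Suc N"] by (simp add: lessThan_Suc_atMost mult.assoc)
  then have "A = W * I * (\<Sum>j\<le>N. z ^ j) + fps_X ^ Suc N * (A * (fps_const x * I) ^ Suc N)"
    by (simp add: z_def power_mult_distrib algebra_simps)
  then have "fps_nth A n = fps_nth (W * I * (\<Sum>j\<le>N. z ^ j)) n
      + fps_nth (fps_X ^ Suc N * (A * (fps_const x * I) ^ Suc N)) n"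
    by (metis fps_add_nth)
  also have "fps_nth (fps_X ^ Suc N * (A * (fps_const x * I) ^ Suc N)) n = 0"
    using \<open>n \<le> N\<close> by (simp only: fps_X_power_mult_nth) simp
  also have "W * I * (\<Sum>j\<le>N. z ^ j) = (\<Sum>j\<le>N. fps_const (x ^ j) * (W * I * (fps_X * I) ^ j))"
    by (simp add: z_def sum_distrib_left power_mult_distrib fps_const_power mult_ac)
  finally show ?thesis
    by (simp add: fps_sum_nth)
qed

section \<open>Integrals of the CSK polynomials\<close>

lemma (in prob_space) integral_abs_le_const:
  fixes r :: "'a \<Rightarrow> real"
  assumes r: "r \<in> borel_measurable M" and bound: "AE x in M. \<bar>r x\<bar> \<le> C"
  shows "\<bar>integral\<^sup>L M r\<bar> \<le> C"
proof -
  have int: "integrable M r"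
    using bound r by (intro integrable_const_bound[where B = C]) auto
  have "\<bar>integral\<^sup>L M r\<bar> \<le> (LINT x|M. \<bar>r x\<bar>)"
    by (rule integral_abs_bound)
  also have "\<dots> \<le> (LINT x|M. C)"
    using int bound by (intro integral_mono_AE) auto
  also have "\<dots> = C" by (simp add: prob_space)
  finally show ?thesis .
qed

lemma prob_space_density_integral:
  fixes f :: "'a \<Rightarrow> real"
  assumes f: "f \<in> borel_measurable M" and nonneg: "AE x in M. 0 \<le> f x"
    and "prob_space (density M (\<lambda>x. ennreal (f x)))"
  shows "integral\<^sup>L M f = 1"
proof -
  have "(\<integral>\<^sup>+x. ennreal (f x) \<partial>M) = emeasure (density M (\<lambda>x. ennreal (f x))) (space M)"
    using f by (subst emeasure_density) (auto intro!: nn_integral_cong)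
  also have "\<dots> = 1"
    using prob_space.emeasure_space_1[OF assms(3)] by simp
  finally show ?thesis
    using f nonneg by (simp add: integral_eq_nn_integral)
qed

locale bounded_real_distribution = real_distribution M for M +
  fixes B :: real
  assumes AE_bounded: "AE x in M. \<bar>x\<bar> \<le> B"
begin

lemma integrable_power: "integrable M (\<lambda>x. x ^ n)"
proof (rule integrable_const_bound)
  show "AE x in M. norm (x ^ n) \<le> B ^ n"
    using AE_bounded by eventually_elim (simp add: power_abs power_mono)
qed simp

lemma integrable_poly: "integrable M (\<lambda>x. poly p x)"
  unfolding poly_altdef by (intro Bochner_Integration.integrable_sum integrable_mult_right integrable_power)

text \<open>For small \<open>m\<close> the density is \<open>g / (1 - t x)\<close> with \<open>g = V m / (V m + m\<^sup>2)\<close> and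
  \<open>t = m / (V m + m\<^sup>2)\<close>.  Its integral is \<open>1\<close>; cutting off the geometric series after
  \<open>N\<close> leaves a polynomial in the moments and an error of the order \<open>m ^ Suc N\<close>, uniformly
  on the bounded support.\<close>

lemma csk_truncated_moment_series:
  fixes V :: "real \<Rightarrow> real"
  assumes var: "csk_variance_function M V" and V: "V has_fps_expansion W"
    and W0: "fps_nth W 0 \<noteq> 0"
  defines "i \<equiv> \<lambda>m. inverse (V m + m ^ 2)"
  shows "\<exists>C. \<forall>\<^sub>F m in nhds 0.
    \<bar>(\<Sum>j\<le>N. (LINT x|M. x ^ j) * (V m * i m * (m * i m) ^ j)) - 1\<bar> \<le> C * \<bar>m\<bar> ^ Suc N"
proof -
  obtain lo hi where lo: "lo < 0" and hi: "0 < hi" and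
    den: "\<And>m. m \<in> {lo<..<hi} \<Longrightarrow> AE x in M. V m + m * (m - x) \<noteq> 0 \<and> 0 \<le> csk_density V x m" and
    prob: "\<And>m. m \<in> {lo<..<hi} \<Longrightarrow> prob_space (density M (\<lambda>x. ennreal (csk_density V x m)))"
    using var unfolding csk_variance_function_def by blast
  have V0: "V 0 \<noteq> 0"
    using W0 has_fps_expansion_nth_0_real[OF V] by simp
  have e: "(\<lambda>m. V m + m ^ 2) has_fps_expansion W + fps_X ^ 2"
    by (intro fps_expansion_intros V)
  have i: "i has_fps_expansion inverse (W + fps_X ^ 2)"
    unfolding i_def using W0 by (intro has_fps_expansion_inverse e) simp
  have g: "(\<lambda>m. V m * i m) has_fps_expansion W * inverse (W + fps_X ^ 2)"
    by (intro has_fps_expansion_mult V i)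
  define K where "K = \<bar>i 0\<bar> + 1"
  define J where "J = \<bar>V 0 * i 0\<bar> + 1"
  \<comment> \<open>Below, \<open>\<bar>t\<bar> \<le> K * \<bar>m\<bar>\<close>, and \<open>\<bar>m\<bar> < 1 / (2 * K * B')\<close> keeps \<open>\<bar>t * x\<bar> \<le> 1 / 2\<close> on the
      support.\<close>
  define B' where "B' = \<bar>B\<bar> + 1"
  have pos: "K > 0" "J > 0" "B' > 0" by (simp_all add: K_def J_def B'_def add_nonneg_pos)
  have ev_i: "\<forall>\<^sub>F m in nhds 0. \<bar>i m\<bar> \<le> K"
    unfolding K_def by (rule has_fps_expansion_eventually_bounded[OF i])
  have ev_g: "\<forall>\<^sub>F m in nhds 0. \<bar>V m * i m\<bar> \<le> J"
    unfolding J_def by (rule has_fps_expansion_eventually_bounded[OF g])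
  have "isCont (\<lambda>m. V m + m ^ 2) 0"
    using e by (rule has_fps_expansion_imp_continuous)
  then have "((\<lambda>m. V m + m ^ 2) \<longlongrightarrow> V 0) (nhds 0)"
    using tendsto_at_iff_tendsto_nhds[of "\<lambda>m. V m + m ^ 2" 0] by (simp add: isCont_def)
  then have ev_e: "\<forall>\<^sub>F m in nhds 0. V m + m ^ 2 \<noteq> 0"
    using V0 by (rule tendsto_imp_eventually_ne)
  have ev_int: "\<forall>\<^sub>F m in nhds 0. m \<in> {lo<..<hi}"
    using lo hi by (intro eventually_nhds_in_open) auto
  have ev_small: "\<forall>\<^sub>F m in nhds (0::real). m \<in> {-1 / (2 * K * B')<..<1 / (2 * K * B')}"
    using pos by (intro eventually_nhds_in_open) (auto simp: field_simps)
  have "\<forall>\<^sub>F m in nhds 0.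
    \<bar>(\<Sum>j\<le>N. (LINT x|M. x ^ j) * (V m * i m * (m * i m) ^ j)) - 1\<bar>
      \<le> (J * (K * B') ^ Suc N * 2) * \<bar>m\<bar> ^ Suc N"
    using ev_i ev_g ev_e ev_int ev_small
  proof eventually_elim
    case (elim m)
    define t where "t = m * i m"
    define g where "g = V m * i m"
    have tK: "\<bar>t\<bar> \<le> K * \<bar>m\<bar>"
      using mult_right_mono[OF elim(1), of "\<bar>m\<bar>"] by (simp add: t_def abs_mult mult.commute)
    have mK: "K * \<bar>m\<bar> * B' \<le> 1 / 2"
      using elim(5) pos by (auto simp: field_simps abs_if)
    have f_eq: "csk_density V x m = g / (1 - t * x)" for x
    proof (cases "m = 0")
      case True
      then show ?thesis using V0 by (simp add: csk_density_def g_def t_def i_def)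
    next
      case False
      have "V m + m * (m - x) = (V m + m ^ 2) * (1 - t * x)"
        using elim(3) by (simp add: t_def i_def field_simps power2_eq_square)
      then show ?thesis
        using False by (simp add: csk_density_def g_def i_def divide_inverse)
    qed
    have int_f: "(LINT x|M. g / (1 - t * x)) = 1"
      using prob_space_density_integral[of "\<lambda>x. csk_density V x m" M] den[OF elim(4)] prob[OF elim(4)]
      unfolding f_eq by fastforce
    define S where "S x = (\<Sum>j\<le>N. x ^ j * (g * t ^ j))" for x
    define r where "r x = g / (1 - t * x) - S x" for x
    have "AE x in M. \<bar>r x\<bar> \<le> J * (K * \<bar>m\<bar> * B') ^ Suc N * 2"
      using AE_bounded
    proof eventually_elim
      case (elim x)
      have "\<bar>t * x\<bar> \<le> K * \<bar>m\<bar> * B'"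
        unfolding abs_mult using tK elim pos by (intro mult_mono) (auto simp: B'_def)
      then have tx: "\<bar>t * x\<bar> \<le> K * \<bar>m\<bar> * B'" "\<bar>t * x\<bar> \<le> 1 / 2" using mK by auto
      have "(1 - t * x) * S x = g * (1 - (t * x) ^ Suc N)"
        unfolding one_diff_power_eq[of "t * x" "Suc N"]
        by (simp add: S_def lessThan_Suc_atMost sum_distrib_left power_mult_distrib mult_ac)
      moreover have "1 - t * x \<noteq> 0" using tx by auto
      ultimately have "r x = g * (t * x) ^ Suc N * (1 / (1 - t * x))"
        by (simp add: r_def field_simps)
      then have "\<bar>r x\<bar> = \<bar>g\<bar> * \<bar>t * x\<bar> ^ Suc N * \<bar>1 / (1 - t * x)\<bar>"
        by (simp only: abs_mult power_abs)
      also have "\<dots> \<le> J * (K * \<bar>m\<bar> * B') ^ Suc N * 2"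
      proof (intro mult_mono power_mono)
        show "\<bar>g\<bar> \<le> J" using \<open>\<bar>V m * i m\<bar> \<le> J\<close> by (simp add: g_def)
        have "1 / 2 \<le> 1 - t * x" using tx by linarith
        then show "\<bar>1 / (1 - t * x)\<bar> \<le> 2" by (simp add: divide_le_eq)
      qed (use tx pos in auto)
      finally show ?case .
    qed
    then have "\<bar>integral\<^sup>L M r\<bar> \<le> J * (K * \<bar>m\<bar> * B') ^ Suc N * 2"
      unfolding r_def S_def by (intro integral_abs_le_const) measurable
    moreover have "integral\<^sup>L M r = 1 - (\<Sum>j\<le>N. (LINT x|M. x ^ j) * (g * t ^ j))"
    proof -
      have int_S: "integrable M S"
        unfolding S_def by (intro Bochner_Integration.integrable_sum integrable_mult_left integrable_power)
      have "integrable M (\<lambda>x. g / (1 - t * x))"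
        using int_f not_integrable_integral_eq by fastforce
      then have "integral\<^sup>L M r = 1 - integral\<^sup>L M S"
        unfolding r_def using int_S int_f by simp
      also have "integral\<^sup>L M S = (\<Sum>j\<le>N. (LINT x|M. x ^ j) * (g * t ^ j))"
        unfolding S_def
        by (subst Bochner_Integration.integral_sum) (auto intro: integrable_mult_left integrable_power)
      finally show ?thesis .
    qed
    ultimately show ?case
      by (simp add: g_def t_def power_mult_distrib mult_ac abs_minus_commute)
  qed
  then show ?thesis by blast
qed

text \<open>The integral of the generating function is the constant \<open>1\<close>, whose coefficients of positive
  order vanish.  The \<open>n\<close>-th one is read off from the truncated series \<open>H\<close>, where it is
  the integral of \<open>P n\<close> as a combination of moments.\<close>

lemma csk_polynomials_integral_0:
  fixes V :: "real \<Rightarrow> real" and P :: "nat \<Rightarrow> real poly"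
  assumes var: "csk_variance_function M V" and V: "V has_fps_expansion W"
    and W0: "fps_nth W 0 \<noteq> 0"
    and eq: "\<And>x. Abs_fps (\<lambda>n. poly (P n) x) * (W + fps_X * (fps_X - fps_const x)) = W"
    and "n \<ge> 1"
  shows "(LINT x|M. poly (P n) x) = 0"
proof -
  define I where "I = inverse (W + fps_X ^ 2)"
  define i where "i m = inverse (V m + m ^ 2)" for m
  define H where "H = (\<Sum>j\<le>n. fps_const (LINT x|M. x ^ j) * (W * I * (fps_X * I) ^ j))"
  have i: "i has_fps_expansion I"
    unfolding i_def I_def using W0
    by (intro has_fps_expansion_inverse fps_expansion_intros V) simp
  have H: "(\<lambda>m. (\<Sum>j\<le>n. (LINT x|M. x ^ j) * (V m * i m * (m * i m) ^ j)) - 1) has_fps_expansion H - 1"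
    unfolding H_def by (intro fps_expansion_intros has_fps_expansion_power_real V i)
  obtain C where "\<forall>\<^sub>F m in nhds 0.
      \<bar>(\<Sum>j\<le>n. (LINT x|M. x ^ j) * (V m * i m * (m * i m) ^ j)) - 1\<bar> \<le> C * \<bar>m\<bar> ^ Suc n"
    using csk_truncated_moment_series[OF var V W0, of n] unfolding i_def by blast
  then have "fps_nth (H - 1) n = 0"
    by (rule has_fps_expansion_bigo_imp_nth_0[OF H]) simp
  moreover have "(LINT x|M. poly (P n) x) = fps_nth H n"
  proof -
    have "poly (P n) x = (\<Sum>j\<le>n. x ^ j * fps_nth (W * I * (fps_X * I) ^ j) n)" for x
      using csk_coeff_geometric[OF W0 eq[of x], of n n] unfolding I_def by simp
    then show ?thesis
      by (simp add: H_def fps_sum_nth integrable_power)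
  qed
  ultimately show ?thesis using \<open>n \<ge> 1\<close> by simp
qed

end

section \<open>Equivalence of the three characterisations\<close>

theorem theorem1p3:
  fixes d :: nat and \<nu> :: "real measure" and V :: "real \<Rightarrow> real" and P :: "nat \<Rightarrow> real poly"
  assumes "d \<ge> 1"
    and "real_distribution \<nu>"
    and "nondegenerate \<nu>"
    and "compactly_supported \<nu>"
    and "prob_space.expectation \<nu> (\<lambda>x. x) = 0"
    and "prob_space.variance \<nu> (\<lambda>x. x) = 1"
    and "csk_variance_function \<nu> V"
    and "\<And>x. (\<lambda>m. V m / (V m + m * (m - x))) has_fps_expansion Abs_fps (\<lambda>n. poly (P n) x)"
  defines "S1 \<equiv> \<exists>a :: nat \<Rightarrow> real. \<forall>\<^sub>F m in nhds 0. V m = 1 + (\<Sum>k=1..d+1. a k * m ^ k)"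
    and "S2 \<equiv> \<exists>b :: nat \<Rightarrow> real. P 0 = 1 \<and> P 1 = [:0, 1:] \<and>
      [:0, 1:] * P 1 = P 2 + smult (b 1) (P 1) + P 0 \<and>
      (\<forall>n\<ge>2. [:0, 1:] * P n = P (n + 1) + (\<Sum>k=1..min (d + 1) n. smult (b k) (P (n + 1 - k))))"
    and "S3 \<equiv> d_orthogonal \<nu> d P"
  shows "(S1 \<longleftrightarrow> S2) \<and> (S2 \<longleftrightarrow> S3)"
proof -
  obtain K where "compact K" and K: "AE x in \<nu>. x \<in> K"
    using assms(4) unfolding compactly_supported_def by blast
  then obtain B where B: "\<And>x. x \<in> K \<Longrightarrow> \<bar>x\<bar> \<le> B"
    using compact_imp_bounded[of K] unfolding bounded_iff by auto
  interpret real_distribution \<nu> by fact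
  interpret bounded_real_distribution \<nu> B
    by unfold_locales (use K B in \<open>auto elim: eventually_mono\<close>)
  have "V real_analytic_on {0}" and V0: "V 0 \<noteq> 0"
    using assms(7) unfolding csk_variance_function_def real_analytic_on_def by blast+
  then obtain W where V: "V has_fps_expansion W"
    unfolding real_analytic_on_def by auto
  have W0_nz: "fps_nth W 0 \<noteq> 0"
    using V0 has_fps_expansion_nth_0_real[OF V] by simp
  note eq = csk_fps_functional_equation[OF V W0_nz assms(8)]
  note P0 = csk_polynomial_recurrence(1)[OF W0_nz eq]
  note recW = csk_polynomial_recurrence(2)[OF W0_nz eq]
  define L where "L p = (LINT x|\<nu>. poly p x)" for p
  have L_add: "L (p + q) = L p + L q" for p q
    by (simp add: L_def integrable_poly)
  have L_smult: "L (smult a p) = a * L p" for a p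
    by (simp add: L_def)
  have L_P: "L (P n) = 0" if "n \<ge> 1" for n
    using csk_polynomials_integral_0[OF assms(7) V W0_nz eq that] by (simp add: L_def)
  have L_1: "L 1 = 1"
    using prob_space by (simp add: L_def)
  have L_sq: "L ([:0, 1:] * [:0, 1:]) = 1"
    using assms(5,6) by (simp add: L_def power2_eq_square)

  have P1: "smult (fps_nth W 0) (P 1) = [:0, 1:]"
    using recW[of 0] P0 by simp
  have rec1: "[:0, 1:] * P 1 = smult (fps_nth W 0) (P 2) + smult (fps_nth W 1) (P 1) + P 0"
    using recW[of 1] by (simp add: numeral_2_eq_2)
  \<comment> \<open>Integrating \<open>rec1\<close> gives \<open>1 / V 0\<close> times the variance on the left and \<open>1\<close> on the right.\<close>
  have W0: "fps_nth W 0 = 1"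
  proof -
    have "L ([:0, 1:] * P 1) = 1"
      using L_P[of 1] L_P[of 2] by (simp only: rec1 L_add L_smult) (simp add: P0 L_1)
    then have "L (smult (fps_nth W 0) ([:0, 1:] * P 1)) = fps_nth W 0"
      by (simp add: L_smult del: mult_pCons_left)
    moreover have "smult (fps_nth W 0) ([:0, 1:] * P 1) = [:0, 1:] * [:0, 1:]"
      by (simp only: mult_smult_right[symmetric] P1)
    ultimately show ?thesis using L_sq by simp
  qed
  \<comment> \<open>The term \<open>m\<^sup>2\<close> added to \<open>V\<close> in the denominator shifts the second coefficient by one.\<close>
  define c where "c k = fps_nth W k + (if k = 2 then 1 else 0)" for k
  interpret csk_moment_functional P c L
  proof
    show "P 0 = 1" by (rule P0)
    show "P 1 = [:0, 1:]" using P1 W0 by simp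
    show "[:0, 1:] * P 1 = P 2 + smult (c 1) (P 1) + P 0"
      using rec1 W0 by (simp add: c_def)
    fix n :: nat assume n: "n \<ge> 2"
    have "{..n} = insert 0 {1..n}" by auto
    then have "(\<Sum>k\<le>n. smult (fps_nth W k) (P (n + 1 - k)))
        = P (n + 1) + (\<Sum>k=1..n. smult (fps_nth W k) (P (n + 1 - k)))"
      using W0 by simp
    moreover have "(\<Sum>k=1..n. smult (c k) (P (n + 1 - k)))
        = (\<Sum>k=1..n. smult (fps_nth W k) (P (n + 1 - k)))
          + (\<Sum>k=1..n. if k = 2 then P (n + 1 - k) else 0)"
      unfolding sum.distrib[symmetric] by (intro sum.cong) (auto simp: c_def smult_add_left)
    moreover have "(\<Sum>k=1..n. if k = 2 then P (n + 1 - k) else 0) = P (n - 1)"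
      using n by (subst sum.delta) auto
    ultimately show "[:0, 1:] * P n = P (n + 1) + (\<Sum>k=1..n. smult (c k) (P (n + 1 - k)))"
      using recW[of n] n by (simp add: add.assoc del: mult_pCons_left)
  qed (fact L_add L_smult L_1 L_P)+
  have "S1 \<longleftrightarrow> (\<forall>k>d+1. c k = 0)"
    unfolding S1_def eventually_polynomial_iff[OF V W0] using \<open>d \<ge> 1\<close> by (auto simp: c_def)
  moreover have "S2 \<longleftrightarrow> (\<forall>k>d+1. c k = 0)"
    unfolding S2_def by (rule banded_recurrence_iff)
  moreover have "S3 \<longleftrightarrow> (\<forall>k>d+1. c k = 0)"
    unfolding S3_def d_orthogonal_def using orthogonal_iff[of d] L_P
    by (simp add: degree_P P0 integrable_power L_def)
  ultimately show ?thesis by blast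
qed

end
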